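(* Let $A,B>0$ be bounded linear operators on a Hilbert space $\mathcal{H}$ such that $sA\le B\le tA$ for some scalars $0<s\le t$, let $v\in[0,1]$, and let $g_v(x)=(1-v)+vx-x^v$ for $s\le x\le t$. (i) If $t\le 1$, then $g_v(t)A\le A\nabla_v B-A\sharp_v B\le g_v(s)A$. (ii) If $s\ge 1$, then $g_v(s)A\le A\nabla_v B-A\sharp_v B\le g_v(t)A$.
   Context: Operators are bounded linear operators on a Hilbert space $\mathcal{H}$. $A\ge 0$ (positive) means $\langle Ax,x\rangle\ge 0$ for all $x\in\mathcal{H}$; $A>0$ (strictly positive) means $A$ is positive and invertible; for self-adjoint $A,B$, $A\le B$ means $B-A\ge 0$. For $A,B>0$ and $v\in[0,1]$: $A\nabla_v B=(1-v)A+vB$ and $A\sharp_v B=A^{1/2}\left(A^{-1/2}BA^{-1/2}\right)^v A^{1/2}$, with powers defined by the continuous functional calculus. *)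

theory Defs
  imports "HOL-Analysis.Analysis" "HOL-Computational_Algebra.Polynomial"
begin

(* Complex inner product spaces, on top of the real inner product Re <x,y>, so that the norm,
   the topology and the space of bounded real-linear maps are those of HOL-Analysis.
   Definiteness of cinner, and norm x = sqrt <x,x>, come from real_inner. *)

class complex_inner = real_inner +
  fixes scaleC :: "complex \<Rightarrow> 'a \<Rightarrow> 'a"  (infixr \<open>*\<^sub>C\<close> 75)
    and cinner :: "'a \<Rightarrow> 'a \<Rightarrow> complex"
  assumes scaleC_add_right: "c *\<^sub>C (x + y) = c *\<^sub>C x + c *\<^sub>C y"
    and scaleC_add_left: "(c + d) *\<^sub>C x = c *\<^sub>C x + d *\<^sub>C x"
    and scaleC_scaleC: "c *\<^sub>C d *\<^sub>C x = (c * d) *\<^sub>C x"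
    and scaleR_scaleC: "r *\<^sub>R x = complex_of_real r *\<^sub>C x"
    and cinner_commute: "cinner x y = cnj (cinner y x)"
    and cinner_add_left: "cinner (x + y) z = cinner x z + cinner y z"
    and cinner_scaleC_left: "cinner (c *\<^sub>C x) y = c * cinner x y"
    and inner_eq_Re_cinner: "inner x y = Re (cinner x y)"

class chilbert_space = complex_inner + complete_space

instantiation complex :: chilbert_space
begin
definition scaleC_complex :: "complex \<Rightarrow> complex \<Rightarrow> complex"
  where "scaleC_complex c x = c * x"
definition cinner_complex :: "complex \<Rightarrow> complex \<Rightarrow> complex"
  where "cinner_complex x y = x * cnj y"
instance
  by standard
    (auto simp: scaleC_complex_def cinner_complex_def inner_complex_def algebra_simps scaleR_conv_of_real)
end

lemma cinner_self: "cinner x x = complex_of_real ((norm x)\<^sup>2)"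
proof (rule complex_eqI)
  show "Re (cinner x x) = Re (complex_of_real ((norm x)\<^sup>2))"
    by (simp add: power2_norm_eq_inner inner_eq_Re_cinner)
  have "Im (cinner x x) = - Im (cinner x x)"
    by (metis cinner_commute complex_cnj cnj.sel(2))
  then show "Im (cinner x x) = Im (complex_of_real ((norm x)\<^sup>2))"
    by simp
qed

lemma norm_scaleC: "norm (c *\<^sub>C x) = cmod c * norm x"
proof -
  have "cinner (c *\<^sub>C x) (c *\<^sub>C x) = c * cnj c * cinner x x"
    by (metis cinner_commute cinner_scaleC_left complex_cnj_mult mult.assoc mult.left_commute)
  also have "c * cnj c = complex_of_real ((cmod c)\<^sup>2)"
    by (simp add: complex_norm_square del: of_real_power)
  finally have "complex_of_real ((norm (c *\<^sub>C x))\<^sup>2) = complex_of_real ((cmod c * norm x)\<^sup>2)"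
    by (simp only: cinner_self of_real_mult power_mult_distrib)
  then have "(norm (c *\<^sub>C x))\<^sup>2 = (cmod c * norm x)\<^sup>2"
    using of_real_eq_iff by blast
  then show ?thesis
    by (simp add: power2_eq_iff_nonneg)
qed

lift_definition scalar_op :: "complex \<Rightarrow> 'a::complex_inner \<Rightarrow>\<^sub>L 'a" is "\<lambda>c x. c *\<^sub>C x"
  by (rule bounded_linear_intro[where K = "cmod c" for c])
    (auto simp: scaleC_add_right scaleR_scaleC scaleC_scaleC norm_scaleC mult.commute)

(* The type 'a \<Rightarrow>\<^sub>L 'a only provides real-linearity. The operators on the complex space are its
   elements satisfying complex_linear. *)

definition complex_linear :: "('a::complex_inner \<Rightarrow>\<^sub>L 'a) \<Rightarrow> bool"
  where "complex_linear T \<longleftrightarrow> (\<forall>c x. T (c *\<^sub>C x) = c *\<^sub>C T x)"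

definition self_adjoint :: "('a::complex_inner \<Rightarrow>\<^sub>L 'a) \<Rightarrow> bool"
  where "self_adjoint T \<longleftrightarrow> complex_linear T \<and> (\<forall>x y. cinner (T x) y = cinner x (T y))"

definition positive_op :: "('a::complex_inner \<Rightarrow>\<^sub>L 'a) \<Rightarrow> bool"
  where "positive_op T \<longleftrightarrow> complex_linear T \<and> (\<forall>x. cinner (T x) x \<in> \<real>\<^sub>\<ge>\<^sub>0)"

definition invertible_op :: "('a::complex_inner \<Rightarrow>\<^sub>L 'a) \<Rightarrow> bool"
  where "invertible_op T \<longleftrightarrow>
    (\<exists>S. complex_linear S \<and> T o\<^sub>L S = id_blinfun \<and> S o\<^sub>L T = id_blinfun)"

definition strictly_positive_op :: "('a::complex_inner \<Rightarrow>\<^sub>L 'a) \<Rightarrow> bool"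
  where "strictly_positive_op T \<longleftrightarrow> positive_op T \<and> invertible_op T"

definition op_le :: "('a::complex_inner \<Rightarrow>\<^sub>L 'a) \<Rightarrow> ('a \<Rightarrow>\<^sub>L 'a) \<Rightarrow> bool"  (infix \<open>\<le>\<^sub>o\<^sub>p\<close> 50)
  where "S \<le>\<^sub>o\<^sub>p T \<longleftrightarrow> self_adjoint S \<and> self_adjoint T \<and> positive_op (T - S)"

definition op_spectrum :: "('a::complex_inner \<Rightarrow>\<^sub>L 'a) \<Rightarrow> complex set"
  where "op_spectrum T = {z. \<not> invertible_op (T - scalar_op z)}"

definition op_power :: "('a::complex_inner \<Rightarrow>\<^sub>L 'a) \<Rightarrow> nat \<Rightarrow> 'a \<Rightarrow>\<^sub>L 'a"
  where "op_power T n = ((\<lambda>S. T o\<^sub>L S) ^^ n) id_blinfun"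

definition op_poly :: "real poly \<Rightarrow> ('a::complex_inner \<Rightarrow>\<^sub>L 'a) \<Rightarrow> 'a \<Rightarrow>\<^sub>L 'a"
  where "op_poly p T = (\<Sum>i\<le>degree p. coeff p i *\<^sub>R op_power T i)"

(* Continuous functional calculus f(T), for a self-adjoint T and a real function f that is
   continuous on the spectrum of T: the common operator-norm limit of the p_n(T), for all sequences
   of real polynomials p_n converging to f uniformly on the spectrum. As T is self-adjoint, its
   spectrum is a compact set of reals, such sequences exist and the limit does not depend on the
   sequence. The value is unspecified outside this situation. *)

definition cfc :: "(real \<Rightarrow> real) \<Rightarrow> ('a::chilbert_space \<Rightarrow>\<^sub>L 'a) \<Rightarrow> 'a \<Rightarrow>\<^sub>L 'a"
  where "cfc f T = (THE S. \<forall>p :: nat \<Rightarrow> real poly.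
    uniform_limit (complex_of_real -` op_spectrum T) (\<lambda>n x. poly (p n) x) f sequentially \<longrightarrow>
    (\<lambda>n. op_poly (p n) T) \<longlonglongrightarrow> S)"

definition op_powr :: "('a::chilbert_space \<Rightarrow>\<^sub>L 'a) \<Rightarrow> real \<Rightarrow> 'a \<Rightarrow>\<^sub>L 'a"
  where "op_powr T r = cfc (\<lambda>x. x powr r) T"

definition arith_mean :: "real \<Rightarrow> ('a::chilbert_space \<Rightarrow>\<^sub>L 'a) \<Rightarrow> ('a \<Rightarrow>\<^sub>L 'a) \<Rightarrow> 'a \<Rightarrow>\<^sub>L 'a"
  where "arith_mean v A B = (1 - v) *\<^sub>R A + v *\<^sub>R B"

definition geom_mean :: "real \<Rightarrow> ('a::chilbert_space \<Rightarrow>\<^sub>L 'a) \<Rightarrow> ('a \<Rightarrow>\<^sub>L 'a) \<Rightarrow> 'a \<Rightarrow>\<^sub>L 'a"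
  where "geom_mean v A B =
    op_powr A (1/2) o\<^sub>L
    op_powr (op_powr A (-1/2) o\<^sub>L B o\<^sub>L op_powr A (-1/2)) v o\<^sub>L
    op_powr A (1/2)"

definition g_fun :: "real \<Rightarrow> real \<Rightarrow> real"
  where "g_fun v x = (1 - v) + v * x - x powr v"

end

theory Submission
  imports Defs "HOL-Computational_Algebra.Fundamental_Theorem_Algebra"
begin

text \<open>
  Put \<open>C = A\<^sup>-\<^sup>1\<^sup>/\<^sup>2 B A\<^sup>-\<^sup>1\<^sup>/\<^sup>2\<close>. Conjugating \<open>s A \<le> B \<le> t A\<close> by \<open>A\<^sup>-\<^sup>1\<^sup>/\<^sup>2\<close> gives \<open>s \<le> C \<le> t\<close>, and
  the difference of the two means is \<open>A\<^sup>1\<^sup>/\<^sup>2 g\<^sub>v(C) A\<^sup>1\<^sup>/\<^sup>2\<close>. The derivative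
  \<open>v (1 - x\<^sup>v\<^sup>-\<^sup>1)\<close> of \<open>g\<^sub>v\<close> is at most \<open>0\<close> on \<open>(0, 1]\<close> and at least \<open>0\<close> on \<open>[1, \<infinity>)\<close>, so \<open>g\<^sub>v\<close>
  is monotone on either interval. In either case its bounds on \<open>[s, t]\<close> are its values at the end points; they
  become bounds for \<open>g\<^sub>v(C)\<close>, and conjugation by \<open>A\<^sup>1\<^sup>/\<^sup>2\<close> turns these into the claim
  (\<open>means_diff_bounds\<close>).

  The substance lies in the continuous functional calculus: for a self-adjoint \<open>T\<close> it has to be
  well-defined, multiplicative (\<open>cfc_mult\<close>, for \<open>A\<^sup>1\<^sup>/\<^sup>2 A\<^sup>1\<^sup>/\<^sup>2 = A\<close> and
  \<open>A\<^sup>1\<^sup>/\<^sup>2 A\<^sup>-\<^sup>1\<^sup>/\<^sup>2 = 1\<close>) and monotone (\<open>cfc_mono\<close>). All of it rests on one fact about polynomials: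
  if \<open>p \<ge> 0\<close> on the real spectrum of \<open>T\<close>, then \<open>p(T) \<ge> 0\<close> (\<open>op_poly_nonneg\<close>). Indeed, otherwise
  the infimum \<open>m < 0\<close> of the numerical range of \<open>p(T)\<close> is a spectral value of \<open>p(T)\<close>
  (\<open>negative_spectral_value\<close>), whereas \<open>p - m\<close> has no zero on the spectrum of \<open>T\<close> and
  so \<open>p(T) - m\<close> is invertible, by factorization over the reals (\<open>invertible_op_poly\<close>). Applied
  to \<open>d\<^sup>2 - p\<^sup>2\<close>, the same fact bounds \<open>\<parallel>p(T)\<parallel>\<close> by the supremum of \<open>\<bar>p\<bar>\<close> on the spectrum
  (\<open>norm_op_poly_le\<close>), and Weierstrass approximation carries everything over to continuous
  functions.
\<close>

section \<open>Complex-linear and self-adjoint operators in terms of the real inner product\<close>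

instance chilbert_space \<subseteq> banach ..

lemma scaleC_diff_right: "c *\<^sub>C (x - y) = c *\<^sub>C x - c *\<^sub>C (y::'a::complex_inner)"
  by (metis blinfun.diff_right scalar_op.rep_eq)

lemma scaleC_scaleR: "c *\<^sub>C (r *\<^sub>R x) = r *\<^sub>R (c *\<^sub>C (x::'a::complex_inner))"
  by (metis blinfun.scaleR_right scalar_op.rep_eq)

lemma scalar_op_of_real: "scalar_op (complex_of_real r) = r *\<^sub>R id_blinfun"
  by (rule blinfun_eqI) (simp add: scalar_op.rep_eq scaleR_scaleC scaleR_blinfun.rep_eq)

lemma complex_linear_id [simp]: "complex_linear id_blinfun"
  by (simp add: complex_linear_def)

lemma complex_linear_zero [simp]: "complex_linear 0"
  by (simp add: complex_linear_def) (metis blinfun.zero_right scalar_op.rep_eq)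

lemma complex_linear_add:
  "complex_linear S \<Longrightarrow> complex_linear T \<Longrightarrow> complex_linear (S + T)"
  by (simp add: complex_linear_def blinfun.add_left scaleC_add_right)

lemma complex_linear_diff:
  "complex_linear S \<Longrightarrow> complex_linear T \<Longrightarrow> complex_linear (S - T)"
  by (simp add: complex_linear_def blinfun.diff_left scaleC_diff_right)

lemma complex_linear_scaleR: "complex_linear T \<Longrightarrow> complex_linear (r *\<^sub>R T)"
  by (simp add: complex_linear_def blinfun.scaleR_left scaleC_scaleR)

lemma complex_linear_compose:
  "complex_linear S \<Longrightarrow> complex_linear T \<Longrightarrow> complex_linear (S o\<^sub>L T)"
  by (simp add: complex_linear_def)

lemma complex_linear_limit:
  assumes "\<And>n. complex_linear (S n)" and "S \<longlonglongrightarrow> T"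
  shows "complex_linear T"
  unfolding complex_linear_def
proof (intro allI)
  fix c x
  have "(\<lambda>n. S n (c *\<^sub>C x)) \<longlonglongrightarrow> T (c *\<^sub>C x)"
    using assms(2) by (intro tendsto_intros)
  moreover have "(\<lambda>n. scalar_op c (S n x)) \<longlonglongrightarrow> scalar_op c (T x)"
    using assms(2) by (intro tendsto_intros)
  moreover have "S n (c *\<^sub>C x) = scalar_op c (S n x)" for n
    using assms(1) by (simp add: complex_linear_def scalar_op.rep_eq)
  ultimately show "T (c *\<^sub>C x) = c *\<^sub>C T x"
    using LIMSEQ_unique by (auto simp: scalar_op.rep_eq)
qed

text \<open>
  The imaginary part of the complex inner product is a real part as well, since
  \<open>Im z = Re (- \<i> * z)\<close>; so for complex-linear operators symmetry with respect to the real
  inner product is the full self-adjointness. A value \<open>\<langle>T x, x\<rangle>\<close> of a self-adjoint operator is real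
  in any case, so positivity and the order can be tested on the real inner product too.
\<close>

lemma self_adjoint_iff:
  "self_adjoint T \<longleftrightarrow> complex_linear T \<and> (\<forall>x y. inner (T x) y = inner x (T y))"
proof (intro iffI conjI)
  assume "complex_linear T \<and> (\<forall>x y. inner (T x) y = inner x (T y))"
  then have lin: "complex_linear T" and sym: "\<And>x y. inner (T x) y = inner x (T y)"
    by auto
  have Im: "Im (cinner u y) = inner ((- \<i>) *\<^sub>C u) y" for u y :: 'a
    by (simp add: inner_eq_Re_cinner cinner_scaleC_left)
  have "cinner (T x) y = cinner x (T y)" for x y
  proof (rule complex_eqI)
    show "Re (cinner (T x) y) = Re (cinner x (T y))"
      using sym by (simp add: inner_eq_Re_cinner)
    show "Im (cinner (T x) y) = Im (cinner x (T y))"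
      using lin sym unfolding Im complex_linear_def by metis
  qed
  with lin show "self_adjoint T"
    by (simp add: self_adjoint_def)
qed (auto simp: self_adjoint_def inner_eq_Re_cinner)

lemma self_adjoint_complex_linear: "self_adjoint T \<Longrightarrow> complex_linear T"
  by (simp add: self_adjoint_def)

lemma self_adjoint_inner: "self_adjoint T \<Longrightarrow> inner (T x) y = inner x (T y)"
  by (simp add: self_adjoint_iff)

lemma positive_op_iff:
  assumes "self_adjoint T"
  shows "positive_op T \<longleftrightarrow> (\<forall>x. 0 \<le> inner (T x) x)"
proof -
  have "Im (cinner (T x) x) = 0" for x
  proof -
    have "cinner (T x) x = cnj (cinner (T x) x)"
      using assms cinner_commute unfolding self_adjoint_def by metis
    then show ?thesis
      by (metis Reals_cnj_iff complex_is_Real_iff)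
  qed
  then show ?thesis
    using assms by (auto simp: positive_op_def self_adjoint_def complex_nonneg_Reals_iff
        inner_eq_Re_cinner)
qed

lemma self_adjoint_id [simp]: "self_adjoint id_blinfun"
  by (simp add: self_adjoint_iff)

lemma self_adjoint_zero [simp]: "self_adjoint 0"
  by (simp add: self_adjoint_iff)

lemma self_adjoint_add: "self_adjoint S \<Longrightarrow> self_adjoint T \<Longrightarrow> self_adjoint (S + T)"
  by (simp add: self_adjoint_iff complex_linear_add blinfun.add_left inner_simps)

lemma self_adjoint_diff: "self_adjoint S \<Longrightarrow> self_adjoint T \<Longrightarrow> self_adjoint (S - T)"
  by (simp add: self_adjoint_iff complex_linear_diff blinfun.diff_left inner_simps)

lemma self_adjoint_scaleR: "self_adjoint T \<Longrightarrow> self_adjoint (r *\<^sub>R T)"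
  by (simp add: self_adjoint_iff complex_linear_scaleR blinfun.scaleR_left)

lemma self_adjoint_limit:
  assumes "\<And>n. self_adjoint (S n)" and "S \<longlonglongrightarrow> T"
  shows "self_adjoint T"
proof -
  have "inner (T x) y = inner x (T y)" for x y
  proof -
    have "(\<lambda>n. inner (S n x) y) \<longlonglongrightarrow> inner (T x) y"
      using assms(2) by (intro tendsto_intros)
    moreover have "(\<lambda>n. inner x (S n y)) \<longlonglongrightarrow> inner x (T y)"
      using assms(2) by (intro tendsto_intros)
    ultimately show ?thesis
      using LIMSEQ_unique assms(1) by (auto simp: self_adjoint_inner)
  qed
  then show ?thesis
    using complex_linear_limit[OF _ assms(2)] assms(1) by (simp add: self_adjoint_iff)
qed

lemma op_le_iff:
  "S \<le>\<^sub>o\<^sub>p T \<longleftrightarrow> self_adjoint S \<and> self_adjoint T \<and> (\<forall>x. inner (S x) x \<le> inner (T x) x)"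
  using positive_op_iff[OF self_adjoint_diff, of T S]
  by (auto simp: op_le_def blinfun.diff_left inner_diff_left)

lemma abs_inner_blinfun_le:
  fixes T :: "'a::real_inner \<Rightarrow>\<^sub>L 'a"
  shows "\<bar>inner (T x) x\<bar> \<le> norm T * (norm x)\<^sup>2"
proof -
  have "\<bar>inner (T x) x\<bar> \<le> norm (T x) * norm x"
    by (rule Cauchy_Schwarz_ineq2)
  also have "\<dots> \<le> norm T * norm x * norm x"
    by (intro mult_right_mono norm_blinfun) auto
  finally show ?thesis
    by (simp add: power2_eq_square mult.assoc)
qed

section \<open>Invertibility and the real spectrum\<close>

lemma invertible_op_compose:
  assumes "invertible_op S" and "invertible_op T"
  shows "invertible_op (S o\<^sub>L T)"
proof -
  obtain S' T' where *:
    "complex_linear S'" "S o\<^sub>L S' = id_blinfun" "S' o\<^sub>L S = id_blinfun"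
    "complex_linear T'" "T o\<^sub>L T' = id_blinfun" "T' o\<^sub>L T = id_blinfun"
    using assms unfolding invertible_op_def by blast
  then have "S (S' x) = x" "S' (S x) = x" "T (T' x) = x" "T' (T x) = x" for x
    by (metis blinfun_apply_blinfun_compose blinfun_apply_id_blinfun id_apply)+
  then have "S o\<^sub>L T o\<^sub>L (T' o\<^sub>L S') = id_blinfun" "T' o\<^sub>L S' o\<^sub>L (S o\<^sub>L T) = id_blinfun"
    by (auto intro!: blinfun_eqI)
  with * show ?thesis
    unfolding invertible_op_def by (blast intro: complex_linear_compose)
qed

lemma invertible_op_scaleR_id:
  assumes "r \<noteq> 0"
  shows "invertible_op (r *\<^sub>R id_blinfun)"
  unfolding invertible_op_def using assms
  by (intro exI[of _ "inverse r *\<^sub>R id_blinfun"])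
    (auto intro!: complex_linear_scaleR blinfun_eqI simp: blinfun.scaleR_left)

lemma invertible_op_scaleR:
  assumes "invertible_op T" and "r \<noteq> 0"
  shows "invertible_op (r *\<^sub>R T)"
proof -
  have "r *\<^sub>R T = (r *\<^sub>R id_blinfun) o\<^sub>L T"
    by (rule blinfun_eqI) (simp add: blinfun.scaleR_left)
  then show ?thesis
    using assms invertible_op_compose invertible_op_scaleR_id by metis
qed

text \<open>
  The Lax-Milgram argument: for a small step \<open>\<alpha>\<close> the map \<open>x \<mapsto> x - \<alpha> (T x - y)\<close> is a contraction,
  because
  \<open>\<parallel>x - \<alpha> T x\<parallel>\<^sup>2 \<le> (1 - 2 \<alpha> c + \<alpha>\<^sup>2 \<parallel>T\<parallel>\<^sup>2) \<parallel>x\<parallel>\<^sup>2\<close>, and its fixed point solves \<open>T x = y\<close>.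
\<close>

lemma coercive_surj:
  fixes T :: "'a::chilbert_space \<Rightarrow>\<^sub>L 'a"
  assumes "0 < c" and coercive: "\<And>x. c * (norm x)\<^sup>2 \<le> inner (T x) x"
  shows "\<exists>x. T x = y"
proof -
  \<comment> \<open>Adding \<open>c\<close> to the norm makes \<open>0 < c \<le> M\<close>, hence \<open>0 \<le> 1 - c\<^sup>2 / M\<^sup>2 < 1\<close>, also in the zero
    space.\<close>
  define M where "M = norm T + c"
  define \<alpha> where "\<alpha> = c / M\<^sup>2"
  define q where "q = sqrt (1 - c\<^sup>2 / M\<^sup>2)"
  have M: "0 < M" "c \<le> M" "norm T \<le> M"
    using \<open>0 < c\<close> by (simp_all add: M_def add_nonneg_pos)
  then have q2: "0 \<le> 1 - c\<^sup>2 / M\<^sup>2" "1 - c\<^sup>2 / M\<^sup>2 < 1"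
    using \<open>0 < c\<close> by (simp_all add: divide_le_eq power_mono)
  have "0 < \<alpha>"
    using M \<open>0 < c\<close> by (simp add: \<alpha>_def)
  have contr: "norm (x - \<alpha> *\<^sub>R T x) \<le> q * norm x" for x
  proof -
    have "norm (T x) \<le> M * norm x"
      using norm_blinfun[of T x] M by (meson mult_right_mono norm_ge_zero order_trans)
    then have Tx: "(norm (T x))\<^sup>2 \<le> M\<^sup>2 * (norm x)\<^sup>2"
      by (metis norm_ge_zero power_mono power_mult_distrib)
    have "(norm (x - \<alpha> *\<^sub>R T x))\<^sup>2 = (norm x)\<^sup>2 - 2 * \<alpha> * inner (T x) x + \<alpha>\<^sup>2 * (norm (T x))\<^sup>2"
      using dot_norm_neg[of x "\<alpha> *\<^sub>R T x"]
      by (simp add: power_mult_distrib inner_commute[of x "T x"])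
    also have "\<dots> \<le> (norm x)\<^sup>2 - 2 * \<alpha> * (c * (norm x)\<^sup>2) + \<alpha>\<^sup>2 * (M\<^sup>2 * (norm x)\<^sup>2)"
    proof -
      have "2 * \<alpha> * (c * (norm x)\<^sup>2) \<le> 2 * \<alpha> * inner (T x) x"
        by (rule mult_left_mono[OF coercive]) (use \<open>0 < \<alpha>\<close> in simp)
      moreover have "\<alpha>\<^sup>2 * (norm (T x))\<^sup>2 \<le> \<alpha>\<^sup>2 * (M\<^sup>2 * (norm x)\<^sup>2)"
        by (rule mult_left_mono[OF Tx]) simp
      ultimately show ?thesis
        by linarith
    qed
    also have "\<alpha>\<^sup>2 * (M\<^sup>2 * (norm x)\<^sup>2) = c\<^sup>2 / M\<^sup>2 * (norm x)\<^sup>2"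
      using M(1) by (simp add: \<alpha>_def power_divide power2_eq_square)
    also have "(norm x)\<^sup>2 - 2 * \<alpha> * (c * (norm x)\<^sup>2) + c\<^sup>2 / M\<^sup>2 * (norm x)\<^sup>2
        = (1 - c\<^sup>2 / M\<^sup>2) * (norm x)\<^sup>2"
      by (simp add: \<alpha>_def power2_eq_square algebra_simps)
    finally have "(norm (x - \<alpha> *\<^sub>R T x))\<^sup>2 \<le> (q * norm x)\<^sup>2"
      using q2(1) by (simp add: q_def power_mult_distrib)
    then show ?thesis
      by (rule power2_le_imp_le) (use q2(1) in \<open>simp add: q_def\<close>)
  qed
  define F where "F x = x - \<alpha> *\<^sub>R (T x - y)" for x
  have "\<exists>!x. F x = x"
  proof (rule banach_fix_type)
    show "0 \<le> q" "q < 1"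
      using q2 by (auto simp: q_def)
    show "\<forall>x x'. dist (F x) (F x') \<le> q * dist x x'"
    proof (intro allI)
      fix x x'
      have "F x - F x' = (x - x') - \<alpha> *\<^sub>R T (x - x')"
        by (simp add: F_def blinfun.diff_right algebra_simps)
      then show "dist (F x) (F x') \<le> q * dist x x'"
        using contr by (simp add: dist_norm)
    qed
  qed
  then show ?thesis
    using \<open>0 < \<alpha>\<close> by (auto simp: F_def)
qed

lemma coercive_invertible:
  fixes T :: "'a::chilbert_space \<Rightarrow>\<^sub>L 'a"
  assumes lin: "complex_linear T" and "0 < c"
    and coercive: "\<And>x. c * (norm x)\<^sup>2 \<le> inner (T x) x"
  shows "invertible_op T"
proof -
  have below: "c * norm x \<le> norm (T x)" for x
  proof (cases "x = 0")
    case False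
    have "c * norm x * norm x \<le> norm (T x) * norm x"
      using coercive[of x] norm_cauchy_schwarz[of "T x" x] by (simp add: power2_eq_square mult.assoc)
    with False show ?thesis
      by simp
  qed simp
  have inj: "x = x'" if "T x = T x'" for x x'
  proof -
    have "c * norm (x - x') \<le> 0"
      using below[of "x - x'"] that by (simp add: blinfun.diff_right)
    then have "norm (x - x') \<le> 0"
      using \<open>0 < c\<close> by (simp add: mult_le_0_iff)
    then show ?thesis
      by simp
  qed
  obtain g where g: "\<And>y. T (g y) = y"
    using coercive_surj[OF \<open>0 < c\<close> coercive] by metis
  have gT: "g (T x) = x" for x
    using inj g by blast
  have "bounded_linear g"
  proof (rule bounded_linear_intro)
    show "g (x + y) = g x + g y" for x y
      by (rule inj) (simp add: g blinfun.add_right)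
    show "g (r *\<^sub>R x) = r *\<^sub>R g x" for r x
      by (rule inj) (simp add: g blinfun.scaleR_right)
    show "norm (g x) \<le> norm x * inverse c" for x
      using below[of "g x"] \<open>0 < c\<close> by (simp add: g field_simps)
  qed
  then have G: "blinfun_apply (Blinfun g) = g"
    by (rule bounded_linear_Blinfun_apply)
  have "complex_linear (Blinfun g)"
    using lin inj g unfolding complex_linear_def G by metis
  moreover have "T o\<^sub>L Blinfun g = id_blinfun" "Blinfun g o\<^sub>L T = id_blinfun"
    by (auto intro!: blinfun_eqI simp: G g gT)
  ultimately show ?thesis
    unfolding invertible_op_def by blast
qed

text \<open>
  Positivity of \<open>P\<close> at the vector \<open>x - P x / k\<close> with \<open>k > \<parallel>P\<parallel>\<close> gives
  \<open>\<langle>P x, x\<rangle> \<ge> \<parallel>P x\<parallel>\<^sup>2 / k\<close>, and an invertible operator is bounded below.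
\<close>

lemma positive_invertible_coercive:
  assumes sa: "self_adjoint P" and pos: "\<And>x. 0 \<le> inner (P x) x" and inv: "invertible_op P"
  obtains c where "0 < c" and "\<And>x. c * (norm x)\<^sup>2 \<le> inner (P x) x"
proof -
  obtain K where "K o\<^sub>L P = id_blinfun"
    using inv unfolding invertible_op_def by blast
  then have K: "K (P x) = x" for x
    by (metis blinfun_apply_blinfun_compose blinfun_apply_id_blinfun id_apply)
  define k l where "k = norm P + 1" and "l = norm K + 1"
  have kl: "0 < k" "0 < l" "norm P \<le> k" "norm K \<le> l"
    by (simp_all add: k_def l_def add_nonneg_pos)
  have "inverse (k * l\<^sup>2) * (norm x)\<^sup>2 \<le> inner (P x) x" for x
  proof -
    have "inner (P (P x)) (P x) \<le> norm P * (norm (P x))\<^sup>2"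
      using abs_inner_blinfun_le[of P "P x"] by linarith
    also have "\<dots> \<le> k * (norm (P x))\<^sup>2"
      using kl(3) by (rule mult_right_mono) simp
    finally have "(inverse k)\<^sup>2 * inner (P (P x)) (P x) \<le> (inverse k)\<^sup>2 * (k * (norm (P x))\<^sup>2)"
      by (rule mult_left_mono) simp
    moreover have "0 \<le> inner (P (x - inverse k *\<^sub>R P x)) (x - inverse k *\<^sub>R P x)"
      by (rule pos)
    moreover have "inner (P (x - inverse k *\<^sub>R P x)) (x - inverse k *\<^sub>R P x)
        = inner (P x) x - 2 * inverse k * (norm (P x))\<^sup>2
          + (inverse k)\<^sup>2 * inner (P (P x)) (P x)"
      using self_adjoint_inner[OF sa, of "P x" x] unfolding power2_norm_eq_inner
      by (simp add: blinfun.bilinear_simps inner_simps power2_eq_square algebra_simps)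
    moreover have "(inverse k)\<^sup>2 * (k * (norm (P x))\<^sup>2) = inverse k * (norm (P x))\<^sup>2"
      using kl by (simp add: power2_eq_square field_simps)
    ultimately have 1: "inverse k * (norm (P x))\<^sup>2 \<le> inner (P x) x"
      by linarith
    have "norm x \<le> l * norm (P x)"
      using norm_blinfun[of K "P x"] kl K[of x] by (metis mult_right_mono norm_ge_zero order_trans)
    then have "(norm x)\<^sup>2 \<le> l\<^sup>2 * (norm (P x))\<^sup>2"
      by (metis norm_ge_zero power_mono power_mult_distrib)
    then have "inverse (k * l\<^sup>2) * (norm x)\<^sup>2 \<le> inverse (k * l\<^sup>2) * (l\<^sup>2 * (norm (P x))\<^sup>2)"
      using kl by (intro mult_left_mono) auto
    also have "\<dots> = inverse k * (norm (P x))\<^sup>2"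
      using kl by (simp add: field_simps)
    finally show ?thesis
      using 1 by simp
  qed
  moreover have "0 < inverse (k * l\<^sup>2)"
    using kl by simp
  ultimately show ?thesis
    using that by blast
qed

lemma real_spectrum_iff:
  "x \<in> complex_of_real -` op_spectrum T \<longleftrightarrow> \<not> invertible_op (T - x *\<^sub>R id_blinfun)"
  by (simp add: op_spectrum_def scalar_op_of_real)

text \<open>
  The infimum \<open>m\<close> of the numerical range of a self-adjoint operator \<open>S\<close> lies in its spectrum:
  \<open>S - m\<close> is positive, so its invertibility would make it coercive, and then \<open>m\<close> would not be the
  largest lower bound.
\<close>

lemma negative_spectral_value:
  assumes sa: "self_adjoint S" and neg: "inner (S z) z < 0"
  obtains m where "m < 0" and "m \<in> complex_of_real -` op_spectrum S"
proof -
  define L where "L = {m. \<forall>x. m * (norm x)\<^sup>2 \<le> inner (S x) x}"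
  define m where "m = Sup L"
  have quot: "l \<le> inner (S x) x / (norm x)\<^sup>2" if "l \<in> L" "x \<noteq> 0" for l x
    using that by (simp add: L_def pos_le_divide_eq)
  have "z \<noteq> 0"
    using neg by auto
  have "- norm S \<in> L"
    unfolding L_def
  proof (intro CollectI allI)
    show "- norm S * (norm x)\<^sup>2 \<le> inner (S x) x" for x
      using abs_inner_blinfun_le[of S x] by linarith
  qed
  then have ne: "L \<noteq> {}"
    by auto
  have bdd: "bdd_above L"
    using quot[OF _ \<open>z \<noteq> 0\<close>] by (rule bdd_aboveI)
  have "m \<le> inner (S x) x / (norm x)\<^sup>2" if "x \<noteq> 0" for x
    unfolding m_def using quot[OF _ that] by (rule cSup_least[OF ne])
  then have m: "m * (norm x)\<^sup>2 \<le> inner (S x) x" for x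
    by (cases "x = 0") (auto simp: pos_le_divide_eq)
  have "m * (norm z)\<^sup>2 < 0"
    using m[of z] neg by simp
  then have "m < 0"
    by (simp add: mult_less_0_iff)
  moreover have "\<not> invertible_op (S - m *\<^sub>R id_blinfun)"
  proof
    assume inv: "invertible_op (S - m *\<^sub>R id_blinfun)"
    have inner_eq: "inner ((S - m *\<^sub>R id_blinfun) x) x = inner (S x) x - m * (norm x)\<^sup>2" for x
      by (simp add: blinfun.bilinear_simps inner_simps power2_norm_eq_inner)
    obtain c where "0 < c" and c: "\<And>x. c * (norm x)\<^sup>2 \<le> inner ((S - m *\<^sub>R id_blinfun) x) x"
      using positive_invertible_coercive[OF _ _ inv] sa m
      by (auto simp: inner_eq self_adjoint_diff self_adjoint_scaleR)
    have "m + c \<in> L"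
      using c unfolding L_def inner_eq by (auto simp: algebra_simps)
    then have "m + c \<le> m"
      unfolding m_def using bdd by (rule cSup_upper)
    with \<open>0 < c\<close> show False
      by simp
  qed
  ultimately show ?thesis
    using that unfolding real_spectrum_iff by blast
qed

lemma real_spectrum_subset:
  fixes T :: "'a::chilbert_space \<Rightarrow>\<^sub>L 'a"
  assumes lower: "a *\<^sub>R id_blinfun \<le>\<^sub>o\<^sub>p T" and upper: "T \<le>\<^sub>o\<^sub>p b *\<^sub>R id_blinfun"
  shows "complex_of_real -` op_spectrum T \<subseteq> {a..b}"
proof
  fix x
  assume x: "x \<in> complex_of_real -` op_spectrum T"
  have lin: "complex_linear T"
    using lower by (simp add: op_le_iff self_adjoint_complex_linear)
  have "invertible_op (T - x *\<^sub>R id_blinfun)" if "x < a"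
  proof (rule coercive_invertible)
    show "(a - x) * (norm y)\<^sup>2 \<le> inner ((T - x *\<^sub>R id_blinfun) y) y" for y
      using lower by (auto simp: op_le_iff blinfun.bilinear_simps inner_simps
          power2_norm_eq_inner algebra_simps)
  qed (use that lin in \<open>auto intro!: complex_linear_diff complex_linear_scaleR\<close>)
  moreover have "invertible_op (T - x *\<^sub>R id_blinfun)" if "b < x"
  proof -
    have "invertible_op (x *\<^sub>R id_blinfun - T)"
    proof (rule coercive_invertible)
      show "(x - b) * (norm y)\<^sup>2 \<le> inner ((x *\<^sub>R id_blinfun - T) y) y" for y
        using upper by (auto simp: op_le_iff blinfun.bilinear_simps inner_simps
            power2_norm_eq_inner algebra_simps)
    qed (use that lin in \<open>auto intro!: complex_linear_diff complex_linear_scaleR\<close>)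
    then show ?thesis
      using invertible_op_scaleR[of "x *\<^sub>R id_blinfun - T" "- 1"] by simp
  qed
  ultimately show "x \<in> {a..b}"
    using x unfolding real_spectrum_iff by force
qed

section \<open>Polynomials of an operator\<close>

lemma op_poly_eq_sum:
  assumes "degree p \<le> n"
  shows "op_poly p T = (\<Sum>i\<le>n. coeff p i *\<^sub>R op_power T i)"
  unfolding op_poly_def using assms
  by (intro sum.mono_neutral_left) (auto simp: coeff_eq_0)

lemma op_poly_0 [simp]: "op_poly 0 T = 0"
  by (simp add: op_poly_def)

lemma op_poly_add: "op_poly (p + q) T = op_poly p T + op_poly q T"
proof -
  define n where "n = max (degree p) (degree q)"
  have "degree (p + q) \<le> n" "degree p \<le> n" "degree q \<le> n"
    by (simp_all add: n_def degree_add_le_max)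
  then show ?thesis
    by (simp add: op_poly_eq_sum[of _ n] scaleR_add_left sum.distrib)
qed

lemma op_poly_smult: "op_poly (smult c p) T = c *\<^sub>R op_poly p T"
  by (simp add: op_poly_eq_sum[OF degree_smult_le] op_poly_def scaleR_sum_right)

lemma op_poly_diff: "op_poly (p - q) T = op_poly p T - op_poly q T"
  using op_poly_add[of p "smult (- 1) q" T] op_poly_smult[of "- 1" q T] by simp

lemma op_poly_pCons: "op_poly (pCons a p) T = a *\<^sub>R id_blinfun + (T o\<^sub>L op_poly p T)"
proof -
  have "op_poly (pCons a p) T
      = (\<Sum>i\<le>Suc (degree p). coeff (pCons a p) i *\<^sub>R op_power T i)"
    by (rule op_poly_eq_sum) (rule degree_pCons_le)
  also have "\<dots> = a *\<^sub>R id_blinfun + (\<Sum>i\<le>degree p. coeff p i *\<^sub>R (T o\<^sub>L op_power T i))"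
    by (simp add: sum.atMost_Suc_shift op_power_def del: sum.atMost_Suc)
  also have "(\<Sum>i\<le>degree p. coeff p i *\<^sub>R (T o\<^sub>L op_power T i)) = T o\<^sub>L op_poly p T"
    by (rule blinfun_eqI) (simp add: op_poly_def blinfun.bilinear_simps blinfun.sum_left
        blinfun.sum_right)
  finally show ?thesis .
qed

lemma op_poly_const: "op_poly [:a:] T = a *\<^sub>R id_blinfun"
  by (simp add: op_poly_pCons)

lemma op_poly_linear: "op_poly [:a, b:] T = a *\<^sub>R id_blinfun + b *\<^sub>R T"
  by (rule blinfun_eqI) (simp add: op_poly_pCons blinfun.bilinear_simps)

lemma op_poly_mult: "op_poly (p * q) T = op_poly p T o\<^sub>L op_poly q T"
proof (induction p)
  case (pCons a p)
  then show ?case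
    by (auto intro!: blinfun_eqI
        simp: mult_pCons_left op_poly_add op_poly_smult op_poly_pCons blinfun.bilinear_simps)
qed simp

lemma op_poly_commute: "T o\<^sub>L op_poly p T = op_poly p T o\<^sub>L T"
proof -
  have "op_poly [:0, 1:] T = T"
    by (simp add: op_poly_linear)
  then show ?thesis
    using op_poly_mult[of "[:0, 1:]" p T] op_poly_mult[of p "[:0, 1:]" T]
    by (simp only: mult.commute[of p "[:0, 1:]"])
qed

lemma self_adjoint_op_poly:
  assumes "self_adjoint T"
  shows "self_adjoint (op_poly p T)"
proof (induction p)
  case (pCons a p)
  have "T (op_poly p T y) = op_poly p T (T y)" for y
    using arg_cong[OF op_poly_commute[of T p], of "\<lambda>S. blinfun_apply S y"] by simp
  then have "self_adjoint (T o\<^sub>L op_poly p T)"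
    using pCons assms by (auto simp: self_adjoint_iff intro!: complex_linear_compose)
  then show ?case
    by (simp add: op_poly_pCons self_adjoint_add self_adjoint_scaleR)
qed simp

text \<open>
  The quadratic factor is the minimal polynomial over the reals of a non-real complex root
  \<open>a + \<i> b\<close>.
\<close>

lemma real_poly_factor:
  fixes p :: "real poly"
  assumes "0 < degree p"
  obtains a q where "p = [:- a, 1:] * q"
    | a b q where "b \<noteq> 0" and "p = [:a\<^sup>2 + b\<^sup>2, - 2 * a, 1:] * q"
proof -
  have hom_add: "map_poly complex_of_real (q + r)
      = map_poly complex_of_real q + map_poly complex_of_real r" for q r
    by (rule poly_eqI) (simp add: coeff_map_poly)
  have hom_mult: "poly (map_poly complex_of_real (q * r)) w
      = poly (map_poly complex_of_real q) w * poly (map_poly complex_of_real r) w" for q r w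
    by (induction q) (simp_all add: hom_add map_poly_pCons map_poly_smult mult_pCons_left
        algebra_simps)
  have hom_real: "poly (map_poly complex_of_real q) (of_real x) = of_real (poly q x)" for q x
    by (induction q) (simp_all add: map_poly_pCons)
  have "degree (map_poly complex_of_real p) = degree p"
    by (simp add: degree_map_poly)
  with assms obtain z where z: "poly (map_poly complex_of_real p) z = 0"
    using fundamental_theorem_of_algebra[of "map_poly complex_of_real p"]
    by (auto simp: constant_degree)
  show ?thesis
  proof (cases "Im z = 0")
    case True
    then have "z = complex_of_real (Re z)"
      by (simp add: complex_eq_iff)
    with z have "poly p (Re z) = 0"
      by (metis of_real_eq_0_iff hom_real)
    then have "[:- Re z, 1:] dvd p"
      by (simp add: poly_eq_0_iff_dvd)
    then show ?thesis
      using that(1) by (auto elim: dvdE)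
  next
    case False
    define m :: "real poly" where "m = [:(Re z)\<^sup>2 + (Im z)\<^sup>2, - 2 * Re z, 1:]"
    have "poly (map_poly complex_of_real m) z = 0"
      by (simp add: m_def map_poly_pCons complex_eq_iff power2_eq_square algebra_simps)
    moreover have "p = m * (p div m) + p mod m"
      by simp
    ultimately have rem: "poly (map_poly complex_of_real (p mod m)) z = 0"
      using z by (metis hom_add hom_mult poly_add add_0 mult_zero_left)
    have "m \<noteq> 0" "degree m = 2"
      by (simp_all add: m_def)
    then have "degree (p mod m) < 2"
      using degree_mod_less'[of m p] by (cases "p mod m = 0") auto
    then have "p mod m = [:coeff (p mod m) 0, coeff (p mod m) 1:]"
      by (intro poly_eqI) (auto simp: coeff_pCons coeff_eq_0 split: nat.splits)
    then obtain u w where uw: "p mod m = [:u, w:]"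
      by blast
    have "w * Im z = 0" "u + w * Re z = 0"
      using rem unfolding uw by (simp_all add: map_poly_pCons complex_eq_iff algebra_simps)
    then have "p mod m = 0"
      using False by (simp add: uw)
    then have "p = m * (p div m)"
      by (metis add.right_neutral mult_div_mod_eq)
    then show ?thesis
      using that(2) False unfolding m_def by blast
  qed
qed

text \<open>
  This is the part of the spectral mapping theorem that gives the bounds below. Linear factors of
  \<open>p(T)\<close> are invertible because their roots avoid the spectrum, quadratic ones
  \<open>(T - a)\<^sup>2 + b\<^sup>2\<close> because they are bounded below by \<open>b\<^sup>2\<close>.
\<close>

lemma invertible_op_poly:
  fixes T :: "'a::chilbert_space \<Rightarrow>\<^sub>L 'a"
  assumes sa: "self_adjoint T" and "p \<noteq> 0"
    and "\<And>x. x \<in> complex_of_real -` op_spectrum T \<Longrightarrow> poly p x \<noteq> 0"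
  shows "invertible_op (op_poly p T)"
  using assms(2,3)
proof (induction "degree p" arbitrary: p rule: less_induct)
  case less
  have step: "invertible_op (op_poly p T)"
    if fac: "p = f * q" "0 < degree f" and inv: "invertible_op (op_poly f T)" for f q
  proof -
    have "q \<noteq> 0" "f \<noteq> 0"
      using less.prems(1) fac by auto
    then have "degree q < degree p"
      using fac by (simp add: degree_mult_eq)
    then have "invertible_op (op_poly q T)"
      using less.hyps[of q] less.prems(2) \<open>q \<noteq> 0\<close> fac by auto
    then show ?thesis
      using inv by (simp add: fac op_poly_mult invertible_op_compose)
  qed
  show ?case
  proof (cases "degree p = 0")
    case True
    then obtain a where "p = [:a:]"
      by (rule degree_eq_zeroE)
    then show ?thesis
      using less.prems(1) by (simp add: op_poly_const invertible_op_scaleR_id)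
  next
    case False
    then have "0 < degree p"
      by simp
    then show ?thesis
    proof (cases rule: real_poly_factor)
      case (1 a q)
      then have "poly p a = 0"
        by simp
      then have "a \<notin> complex_of_real -` op_spectrum T"
        using less.prems(2) by blast
      then have "invertible_op (op_poly [:- a, 1:] T)"
        unfolding real_spectrum_iff by (simp add: op_poly_linear)
      with 1 show ?thesis
        by (intro step) auto
    next
      case (2 a b q)
      have "invertible_op (op_poly [:a\<^sup>2 + b\<^sup>2, - 2 * a, 1:] T)"
      proof (rule coercive_invertible)
        show "complex_linear (op_poly [:a\<^sup>2 + b\<^sup>2, - 2 * a, 1:] T)"
          by (intro self_adjoint_complex_linear self_adjoint_op_poly sa)
        show "0 < b\<^sup>2"
          using 2 by simp
        show "b\<^sup>2 * (norm x)\<^sup>2 \<le> inner (op_poly [:a\<^sup>2 + b\<^sup>2, - 2 * a, 1:] T x) x" for x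
        proof -
          have "inner (op_poly [:a\<^sup>2 + b\<^sup>2, - 2 * a, 1:] T x) x
              = (norm (T x - a *\<^sub>R x))\<^sup>2 + b\<^sup>2 * (norm x)\<^sup>2"
            using self_adjoint_inner[OF sa, of "T x" x] inner_commute[of x "T x"]
            unfolding power2_norm_eq_inner
            by (simp add: op_poly_pCons blinfun.bilinear_simps inner_simps
                power2_eq_square algebra_simps)
          then show ?thesis
            by simp
        qed
      qed
      with 2 show ?thesis
        by (intro step) auto
    qed
  qed
qed

text \<open>Every numerical value of \<open>T - k\<close> at a nonzero vector is negative once \<open>k > \<parallel>T\<parallel>\<close>.\<close>

lemma real_spectrum_nonempty:
  fixes T :: "'a::chilbert_space \<Rightarrow>\<^sub>L 'a"
  assumes sa: "self_adjoint T" and "z \<noteq> (0 :: 'a)"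
  shows "complex_of_real -` op_spectrum T \<noteq> {}"
proof -
  define k where "k = norm T + 1"
  have "self_adjoint (T - k *\<^sub>R id_blinfun)"
    by (simp add: sa self_adjoint_diff self_adjoint_scaleR)
  moreover have "inner ((T - k *\<^sub>R id_blinfun) z) z < 0"
  proof -
    have "inner ((T - k *\<^sub>R id_blinfun) z) z = inner (T z) z - k * (norm z)\<^sup>2"
      by (simp add: blinfun.bilinear_simps inner_simps power2_norm_eq_inner)
    also have "\<dots> \<le> - (norm z)\<^sup>2"
      using abs_inner_blinfun_le[of T z] by (simp add: k_def distrib_right)
    also have "\<dots> < 0"
      using assms(2) by simp
    finally show ?thesis .
  qed
  ultimately obtain m where "m \<in> complex_of_real -` op_spectrum (T - k *\<^sub>R id_blinfun)"
    by (rule negative_spectral_value)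
  then have "\<not> invertible_op (T - (k + m) *\<^sub>R id_blinfun)"
    unfolding real_spectrum_iff by (simp add: algebra_simps)
  then show ?thesis
    unfolding real_spectrum_iff[symmetric] by blast
qed

lemma op_poly_nonneg:
  fixes T :: "'a::chilbert_space \<Rightarrow>\<^sub>L 'a"
  assumes sa: "self_adjoint T"
    and nonneg: "\<And>x. x \<in> complex_of_real -` op_spectrum T \<Longrightarrow> 0 \<le> poly p x"
  shows "0 \<le> inner (op_poly p T z) z"
proof (rule ccontr)
  assume "\<not> ?thesis"
  then have neg: "inner (op_poly p T z) z < 0"
    by simp
  then obtain m where m: "m < 0" "m \<in> complex_of_real -` op_spectrum (op_poly p T)"
    using negative_spectral_value[OF self_adjoint_op_poly[OF sa]] by metis
  have pos: "0 < poly (p - [:m:]) x" if "x \<in> complex_of_real -` op_spectrum T" for x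
    using nonneg[OF that] m(1) by simp
  \<comment> \<open>A negative value of the form needs a nonzero vector, so there is a spectral value at which
    \<open>p - m\<close> does not vanish.\<close>
  have "z \<noteq> 0"
    using neg by auto
  then obtain x where "x \<in> complex_of_real -` op_spectrum T"
    using real_spectrum_nonempty[OF sa] by blast
  then have "p - [:m:] \<noteq> 0"
    using pos[of x] by force
  then have "invertible_op (op_poly (p - [:m:]) T)"
  proof (rule invertible_op_poly[OF sa])
    show "poly (p - [:m:]) x \<noteq> 0" if "x \<in> complex_of_real -` op_spectrum T" for x
      using pos[OF that] by linarith
  qed
  then show False
    using m(2) unfolding real_spectrum_iff by (simp add: op_poly_diff op_poly_const)
qed

text \<open>
  Apply the previous lemma to \<open>d\<^sup>2 - p\<^sup>2\<close>: since \<open>p(T)\<close> is self-adjoint,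
  \<open>\<langle>p\<^sup>2(T) x, x\<rangle> = \<parallel>p(T) x\<parallel>\<^sup>2\<close>.
\<close>

lemma norm_op_poly_le:
  fixes T :: "'a::chilbert_space \<Rightarrow>\<^sub>L 'a"
  assumes sa: "self_adjoint T" and "0 \<le> d"
    and le: "\<And>x. x \<in> complex_of_real -` op_spectrum T \<Longrightarrow> \<bar>poly p x\<bar> \<le> d"
  shows "norm (op_poly p T) \<le> d"
proof (rule norm_blinfun_bound[OF \<open>0 \<le> d\<close>])
  fix z
  have "0 \<le> inner (op_poly ([:d\<^sup>2:] - p * p) T z) z"
  proof (rule op_poly_nonneg[OF sa])
    fix x
    assume "x \<in> complex_of_real -` op_spectrum T"
    then have "\<bar>poly p x\<bar>\<^sup>2 \<le> d\<^sup>2"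
      using le by (intro power_mono) auto
    then show "0 \<le> poly ([:d\<^sup>2:] - p * p) x"
      by (simp add: power2_eq_square)
  qed
  also have "inner (op_poly ([:d\<^sup>2:] - p * p) T z) z = d\<^sup>2 * (norm z)\<^sup>2 - (norm (op_poly p T z))\<^sup>2"
    using self_adjoint_inner[OF self_adjoint_op_poly[OF sa], of p "op_poly p T z" z]
    unfolding power2_norm_eq_inner
    by (simp add: op_poly_diff op_poly_mult op_poly_const blinfun.bilinear_simps inner_simps)
  finally have "(norm (op_poly p T z))\<^sup>2 \<le> (d * norm z)\<^sup>2"
    by (simp add: power_mult_distrib)
  then show "norm (op_poly p T z) \<le> d * norm z"
    by (rule power2_le_imp_le) (use \<open>0 \<le> d\<close> in simp)
qed

section \<open>The continuous functional calculus\<close>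

text \<open>
  Polynomials that approximate \<open>f\<close> uniformly on the spectrum are uniformly close to each other
  there, hence so are their values at \<open>T\<close>. This makes \<open>p\<^sub>n(T)\<close> a Cauchy sequence whose limit does
  not depend on the sequence, which is what the description in the definition of the calculus
  needs.
\<close>

lemma op_poly_dist:
  fixes T :: "'a::chilbert_space \<Rightarrow>\<^sub>L 'a"
  assumes sa: "self_adjoint T" and "0 \<le> d"
    and "\<And>x. x \<in> complex_of_real -` op_spectrum T \<Longrightarrow> \<bar>poly p x - f x\<bar> \<le> d"
    and "\<And>x. x \<in> complex_of_real -` op_spectrum T \<Longrightarrow> \<bar>poly q x - f x\<bar> \<le> d"
  shows "dist (op_poly p T) (op_poly q T) \<le> 2 * d"
proof -
  have "norm (op_poly (p - q) T) \<le> 2 * d"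
  proof (rule norm_op_poly_le[OF sa])
    show "\<bar>poly (p - q) x\<bar> \<le> 2 * d" if "x \<in> complex_of_real -` op_spectrum T" for x
      using assms(3)[OF that] assms(4)[OF that] by (simp add: abs_le_iff)
  qed (use \<open>0 \<le> d\<close> in simp)
  then show ?thesis
    by (simp add: dist_norm op_poly_diff)
qed

lemma uniform_limit_realD:
  fixes f :: "'b \<Rightarrow> real"
  assumes "uniform_limit X g f sequentially" and "0 < d"
  shows "\<forall>\<^sub>F n in sequentially. \<forall>x\<in>X. \<bar>g n x - f x\<bar> < d"
  using uniform_limitD[OF assms] by (simp add: dist_real_def)

lemma cfc_limit:
  fixes T :: "'a::chilbert_space \<Rightarrow>\<^sub>L 'a" and p :: "nat \<Rightarrow> real poly"
  assumes sa: "self_adjoint T"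
    and p: "uniform_limit (complex_of_real -` op_spectrum T) (\<lambda>n x. poly (p n) x) f sequentially"
  shows "(\<lambda>n. op_poly (p n) T) \<longlonglongrightarrow> cfc f T"
proof -
  define X where "X = complex_of_real -` op_spectrum T"
  note p = p[folded X_def]
  note near = op_poly_dist[OF sa, folded X_def]
  have "Cauchy (\<lambda>n. op_poly (p n) T)"
  proof (rule metric_CauchyI)
    fix e :: real
    assume "0 < e"
    then obtain N where N: "\<And>n x. N \<le> n \<Longrightarrow> x \<in> X \<Longrightarrow> \<bar>poly (p n) x - f x\<bar> < e / 3"
      using uniform_limit_realD[OF p, of "e / 3"] by (auto simp: eventually_sequentially)
    have "dist (op_poly (p m) T) (op_poly (p n) T) < e" if "N \<le> m" "N \<le> n" for m n
    proof -
      have "dist (op_poly (p m) T) (op_poly (p n) T) \<le> 2 * (e / 3)"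
        using \<open>0 < e\<close> N[OF that(1)] N[OF that(2)]
        by (intro near[where f = f]) (simp_all add: less_imp_le)
      then show ?thesis
        using \<open>0 < e\<close> by linarith
    qed
    then show "\<exists>M. \<forall>m\<ge>M. \<forall>n\<ge>M. dist (op_poly (p m) T) (op_poly (p n) T) < e"
      by blast
  qed
  then obtain S where S: "(\<lambda>n. op_poly (p n) T) \<longlonglongrightarrow> S"
    using Cauchy_convergent_iff convergent_def by blast
  have indep: "(\<lambda>n. op_poly (q n) T) \<longlonglongrightarrow> S"
    if q: "uniform_limit X (\<lambda>n x. poly (q n) x) f sequentially" for q :: "nat \<Rightarrow> real poly"
  proof (rule Lim_transform[OF S])
    show "(\<lambda>n. op_poly (q n) T - op_poly (p n) T) \<longlonglongrightarrow> 0"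
    proof (rule tendstoI)
      fix e :: real
      assume "0 < e"
      then have "0 < e / 3"
        by simp
      from uniform_limit_realD[OF p this] uniform_limit_realD[OF q this]
      show "\<forall>\<^sub>F n in sequentially. dist (op_poly (q n) T - op_poly (p n) T) 0 < e"
      proof eventually_elim
        case (elim n)
        then have "dist (op_poly (q n) T) (op_poly (p n) T) \<le> 2 * (e / 3)"
          using \<open>0 < e\<close> by (intro near[where f = f]) (simp_all add: less_imp_le)
        then show ?case
          using \<open>0 < e\<close> by (simp add: dist_norm)
      qed
    qed
  qed
  have "cfc f T = S"
    unfolding cfc_def X_def[symmetric]
  proof (rule the_equality)
    show "\<forall>p. uniform_limit X (\<lambda>n x. poly (p n) x) f sequentially \<longrightarrow>
        (\<lambda>n. op_poly (p n) T) \<longlonglongrightarrow> S"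
      using indep by blast
    show "S' = S" if "\<forall>p. uniform_limit X (\<lambda>n x. poly (p n) x) f sequentially \<longrightarrow>
        (\<lambda>n. op_poly (p n) T) \<longlonglongrightarrow> S'" for S'
      using that p S LIMSEQ_unique by blast
  qed
  with S show ?thesis
    by simp
qed

lemma cfc_poly:
  fixes T :: "'a::chilbert_space \<Rightarrow>\<^sub>L 'a"
  assumes "self_adjoint T"
  shows "cfc (poly p) T = op_poly p T"
proof -
  have "(\<lambda>n. op_poly p T) \<longlonglongrightarrow> cfc (poly p) T"
    by (rule cfc_limit[OF assms]) (simp add: uniform_limit_iff)
  then show ?thesis
    using LIMSEQ_unique tendsto_const by blast
qed

lemma uniform_limit_poly:
  fixes f :: "real \<Rightarrow> real"
  assumes "continuous_on {a..b} f"
  obtains p :: "nat \<Rightarrow> real poly"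
  where "uniform_limit {a..b} (\<lambda>n x. poly (p n) x) f sequentially"
proof -
  obtain g where g: "uniform_limit {a..b} g f sequentially" "\<And>n. polynomial_function (g n)"
    using Stone_Weierstrass_uniform_limit[OF compact_Icc assms] by blast
  have "\<exists>q :: real poly. g n = poly q" for n
  proof -
    have "real_polynomial_function (g n)"
      using g(2) by (simp add: real_polynomial_function_eq)
    then obtain c N where "g n = (\<lambda>x. \<Sum>i\<le>N. c i * x ^ i)"
      unfolding real_polynomial_function_iff_sum by blast
    then have "g n = poly (\<Sum>i\<le>N. monom (c i) i)"
      by (simp add: fun_eq_iff poly_sum poly_monom)
    then show ?thesis ..
  qed
  then obtain p where "\<And>n. g n = poly (p n)"
    by metis
  then have "g = (\<lambda>n x. poly (p n) x)"
    by (simp add: fun_eq_iff)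
  with g(1) that show ?thesis
    by blast
qed

text \<open>
  The spectrum of \<open>T\<close> is contained in every interval \<open>[a, b]\<close> with \<open>a \<le> T \<le> b\<close>. The following
  lemmas use such an interval in its place, because operator inequalities, and not spectra, are
  what is known about the operators to which they are applied.
\<close>

lemma cfc_limit_interval:
  fixes T :: "'a::chilbert_space \<Rightarrow>\<^sub>L 'a"
  assumes "a *\<^sub>R id_blinfun \<le>\<^sub>o\<^sub>p T" and "T \<le>\<^sub>o\<^sub>p b *\<^sub>R id_blinfun"
    and "uniform_limit {a..b} (\<lambda>n x. poly (p n) x) f sequentially"
  shows "(\<lambda>n. op_poly (p n) T) \<longlonglongrightarrow> cfc f T"
proof (rule cfc_limit)
  show "self_adjoint T"
    using assms(1) by (simp add: op_le_iff)
  show "uniform_limit (complex_of_real -` op_spectrum T) (\<lambda>n x. poly (p n) x) f sequentially"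
    using assms(3) real_spectrum_subset[OF assms(1,2)] by (rule uniform_limit_on_subset)
qed

lemma self_adjoint_cfc:
  fixes T :: "'a::chilbert_space \<Rightarrow>\<^sub>L 'a"
  assumes bounds: "a *\<^sub>R id_blinfun \<le>\<^sub>o\<^sub>p T" "T \<le>\<^sub>o\<^sub>p b *\<^sub>R id_blinfun"
    and cont: "continuous_on {a..b} f"
  shows "self_adjoint (cfc f T)"
proof -
  obtain p where "uniform_limit {a..b} (\<lambda>n x. poly (p n) x) f sequentially"
    using uniform_limit_poly[OF cont] by blast
  then have "(\<lambda>n. op_poly (p n) T) \<longlonglongrightarrow> cfc f T"
    by (rule cfc_limit_interval[OF bounds])
  moreover have "self_adjoint T"
    using bounds(1) by (simp add: op_le_iff)
  ultimately show ?thesis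
    using self_adjoint_limit self_adjoint_op_poly by metis
qed

lemma cfc_mult:
  fixes T :: "'a::chilbert_space \<Rightarrow>\<^sub>L 'a"
  assumes bounds: "a *\<^sub>R id_blinfun \<le>\<^sub>o\<^sub>p T" "T \<le>\<^sub>o\<^sub>p b *\<^sub>R id_blinfun"
    and cont: "continuous_on {a..b} f" "continuous_on {a..b} g"
    and prod: "\<And>x. x \<in> {a..b} \<Longrightarrow> h x = f x * g x"
  shows "cfc f T o\<^sub>L cfc g T = cfc h T"
proof -
  obtain p where p: "uniform_limit {a..b} (\<lambda>n x. poly (p n) x) f sequentially"
    using uniform_limit_poly[OF cont(1)] by blast
  obtain q where q: "uniform_limit {a..b} (\<lambda>n x. poly (q n) x) g sequentially"
    using uniform_limit_poly[OF cont(2)] by blast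
  have "bounded (f ` {a..b})" "bounded (g ` {a..b})"
    using cont by (auto intro!: compact_imp_bounded compact_continuous_image)
  then have "uniform_limit {a..b} (\<lambda>n x. poly (p n) x * poly (q n) x) (\<lambda>x. f x * g x) sequentially"
    by (rule uniform_lim_mult[OF p q])
  then have "uniform_limit {a..b} (\<lambda>n x. poly (p n * q n) x) h sequentially"
    using prod by (auto simp: uniform_limit_iff)
  then have "(\<lambda>n. op_poly (p n * q n) T) \<longlonglongrightarrow> cfc h T"
    by (rule cfc_limit_interval[OF bounds])
  moreover have "(\<lambda>n. op_poly (p n) T o\<^sub>L op_poly (q n) T) \<longlonglongrightarrow> (cfc f T o\<^sub>L cfc g T)"
    using cfc_limit_interval[OF bounds p] cfc_limit_interval[OF bounds q]
    by (rule bounded_bilinear.tendsto[OF bounded_bilinear_blinfun_compose])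
  ultimately show ?thesis
    using LIMSEQ_unique by (simp add: op_poly_mult) blast
qed

lemma cfc_mono:
  fixes T :: "'a::chilbert_space \<Rightarrow>\<^sub>L 'a"
  assumes bounds: "a *\<^sub>R id_blinfun \<le>\<^sub>o\<^sub>p T" "T \<le>\<^sub>o\<^sub>p b *\<^sub>R id_blinfun"
    and cont: "continuous_on {a..b} f" "continuous_on {a..b} g"
    and le: "\<And>x. x \<in> {a..b} \<Longrightarrow> f x \<le> g x"
  shows "cfc f T \<le>\<^sub>o\<^sub>p cfc g T"
proof -
  have sa: "self_adjoint T"
    using bounds(1) by (simp add: op_le_iff)
  obtain p where p: "uniform_limit {a..b} (\<lambda>n x. poly (p n) x) f sequentially"
    using uniform_limit_poly[OF cont(1)] by blast
  obtain q where q: "uniform_limit {a..b} (\<lambda>n x. poly (q n) x) g sequentially"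
    using uniform_limit_poly[OF cont(2)] by blast
  have "inner (cfc f T z) z \<le> inner (cfc g T z) z" for z
  proof -
    have "- (2 * d * (norm z)\<^sup>2) \<le> inner (cfc g T z) z - inner (cfc f T z) z" if "0 < d" for d
    proof (rule tendsto_lowerbound)
      show "(\<lambda>n. inner (op_poly (q n) T z) z - inner (op_poly (p n) T z) z)
          \<longlonglongrightarrow> inner (cfc g T z) z - inner (cfc f T z) z"
        using cfc_limit_interval[OF bounds p] cfc_limit_interval[OF bounds q]
        by (intro tendsto_intros)
      from uniform_limit_realD[OF p that] uniform_limit_realD[OF q that]
      show "\<forall>\<^sub>F n in sequentially. - (2 * d * (norm z)\<^sup>2)
          \<le> inner (op_poly (q n) T z) z - inner (op_poly (p n) T z) z"
      proof eventually_elim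
        case (elim n)
        \<comment> \<open>The approximants inherit \<open>f \<le> g\<close> only up to twice the approximation error.\<close>
        have "0 \<le> inner (op_poly (q n - p n + [:2 * d:]) T z) z"
        proof (rule op_poly_nonneg[OF sa])
          fix x
          assume "x \<in> complex_of_real -` op_spectrum T"
          then have x: "x \<in> {a..b}"
            using real_spectrum_subset[OF bounds] by blast
          have "\<bar>poly (p n) x - f x\<bar> < d" "\<bar>poly (q n) x - g x\<bar> < d"
            using elim x by blast+
          then have "0 \<le> poly (q n) x - poly (p n) x + 2 * d"
            using le[OF x] by linarith
          then show "0 \<le> poly (q n - p n + [:2 * d:]) x"
            by simp
        qed
        then show ?case
          by (simp add: op_poly_add op_poly_diff op_poly_const blinfun.bilinear_simps
              inner_add_left inner_diff_left power2_norm_eq_inner)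
      qed
    qed simp
    note approx = this
    show ?thesis
    proof (rule field_le_epsilon)
      fix e :: real
      assume "0 < e"
      define k where "k = (norm z)\<^sup>2 + 1"
      have k: "0 < k" "(norm z)\<^sup>2 \<le> k"
        by (simp_all add: k_def add_nonneg_pos)
      have "2 * (e / (2 * k)) * (norm z)\<^sup>2 \<le> e"
        using k \<open>0 < e\<close> by (simp add: divide_le_eq)
      then show "inner (cfc f T z) z \<le> inner (cfc g T z) z + e"
        using approx[of "e / (2 * k)"] k \<open>0 < e\<close> by simp
    qed
  qed
  then show ?thesis
    using self_adjoint_cfc[OF bounds cont(1)] self_adjoint_cfc[OF bounds cont(2)]
    by (simp add: op_le_iff)
qed

section \<open>Operator means\<close>

lemma strictly_positive_bounds:
  assumes "self_adjoint A" and "strictly_positive_op A"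
  obtains c M where "0 < c" and "c *\<^sub>R id_blinfun \<le>\<^sub>o\<^sub>p A" and "A \<le>\<^sub>o\<^sub>p M *\<^sub>R id_blinfun"
proof -
  have "\<And>x. 0 \<le> inner (A x) x" "invertible_op A"
    using assms positive_op_iff by (auto simp: strictly_positive_op_def)
  then obtain c where c: "0 < c" "\<And>x. c * (norm x)\<^sup>2 \<le> inner (A x) x"
    using positive_invertible_coercive[OF assms(1)] by metis
  have "c *\<^sub>R id_blinfun \<le>\<^sub>o\<^sub>p A"
    using assms(1) c(2) by (simp add: op_le_iff self_adjoint_scaleR blinfun.scaleR_left
        power2_norm_eq_inner)
  moreover have "inner (A x) x \<le> norm A * (norm x)\<^sup>2" for x
    using abs_inner_blinfun_le[of A x] by linarith
  then have "A \<le>\<^sub>o\<^sub>p norm A *\<^sub>R id_blinfun"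
    using assms(1) by (simp add: op_le_iff self_adjoint_scaleR blinfun.scaleR_left
        power2_norm_eq_inner)
  ultimately show ?thesis
    using that c(1) by blast
qed

lemma continuous_on_powr_Icc:
  fixes a b r :: real
  assumes "0 < a"
  shows "continuous_on {a..b} (\<lambda>x. x powr r)"
  using assms by (intro continuous_intros) auto

lemma op_powr_half:
  fixes A :: "'a::chilbert_space \<Rightarrow>\<^sub>L 'a"
  assumes sa: "self_adjoint A" and pos: "strictly_positive_op A"
  shows "self_adjoint (op_powr A (1/2))" and "self_adjoint (op_powr A (-1/2))"
    and "op_powr A (1/2) o\<^sub>L op_powr A (1/2) = A"
    and "op_powr A (-1/2) o\<^sub>L op_powr A (1/2) = id_blinfun"
    and "op_powr A (1/2) o\<^sub>L op_powr A (-1/2) = id_blinfun"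
proof -
  obtain c M where "0 < c" and bounds: "c *\<^sub>R id_blinfun \<le>\<^sub>o\<^sub>p A" "A \<le>\<^sub>o\<^sub>p M *\<^sub>R id_blinfun"
    using strictly_positive_bounds[OF sa pos] by blast
  note cont = continuous_on_powr_Icc[OF \<open>0 < c\<close>, of M]
  show "self_adjoint (op_powr A (1/2))" "self_adjoint (op_powr A (-1/2))"
    unfolding op_powr_def by (rule self_adjoint_cfc[OF bounds cont])+
  have "op_powr A (1/2) o\<^sub>L op_powr A (1/2) = cfc (poly [:0, 1:]) A"
    unfolding op_powr_def
    by (rule cfc_mult[OF bounds cont cont]) (use \<open>0 < c\<close> in \<open>simp add: powr_add[symmetric]\<close>)
  then show "op_powr A (1/2) o\<^sub>L op_powr A (1/2) = A"
    by (simp add: cfc_poly[OF sa] op_poly_linear)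
  have "op_powr A (-1/2) o\<^sub>L op_powr A (1/2) = cfc (poly [:1:]) A"
    unfolding op_powr_def
    by (rule cfc_mult[OF bounds cont cont]) (use \<open>0 < c\<close> in \<open>simp add: powr_add[symmetric]\<close>)
  then show "op_powr A (-1/2) o\<^sub>L op_powr A (1/2) = id_blinfun"
    by (simp add: cfc_poly[OF sa] op_poly_const)
  have "op_powr A (1/2) o\<^sub>L op_powr A (-1/2) = cfc (poly [:1:]) A"
    unfolding op_powr_def
    by (rule cfc_mult[OF bounds cont cont]) (use \<open>0 < c\<close> in \<open>simp add: powr_add[symmetric]\<close>)
  then show "op_powr A (1/2) o\<^sub>L op_powr A (-1/2) = id_blinfun"
    by (simp add: cfc_poly[OF sa] op_poly_const)
qed

text \<open>
  With \<open>R = A\<^sup>1\<^sup>/\<^sup>2\<close> and \<open>C = A\<^sup>-\<^sup>1\<^sup>/\<^sup>2 B A\<^sup>-\<^sup>1\<^sup>/\<^sup>2\<close> one has \<open>A = R\<^sup>2\<close>, \<open>B = R C R\<close> and the geometric mean is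
  \<open>R C\<^sup>v R\<close>. So the quadratic forms of the two means at \<open>z\<close> are those of \<open>(1 - v) + v C\<close> and
  \<open>C\<^sup>v\<close> at \<open>R z\<close>, and as \<open>s \<le> C \<le> t\<close> every scalar bound for \<open>g\<^sub>v\<close> on \<open>[s, t]\<close> transfers.
\<close>

lemma means_diff_bounds:
  fixes A B :: "'a::chilbert_space \<Rightarrow>\<^sub>L 'a"
  assumes A: "self_adjoint A" "strictly_positive_op A" and "0 < s"
    and sB: "s *\<^sub>R A \<le>\<^sub>o\<^sub>p B" and Bt: "B \<le>\<^sub>o\<^sub>p t *\<^sub>R A"
    and g: "\<And>x. x \<in> {s..t} \<Longrightarrow> l \<le> g_fun v x \<and> g_fun v x \<le> u"
  shows "l *\<^sub>R A \<le>\<^sub>o\<^sub>p arith_mean v A B - geom_mean v A B"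
    and "arith_mean v A B - geom_mean v A B \<le>\<^sub>o\<^sub>p u *\<^sub>R A"
proof -
  define R where "R = op_powr A (1/2)"
  define Q where "Q = op_powr A (-1/2)"
  define C where "C = Q o\<^sub>L B o\<^sub>L Q"
  define G where "G = op_powr C v"
  note half = op_powr_half[OF A, folded R_def Q_def]
  have R: "inner (R x) y = inner x (R y)" and Q: "inner (Q x) y = inner x (Q y)" for x y
    using half(1,2) by (simp_all add: self_adjoint_inner)
  have RR: "R (R x) = A x" and QR: "Q (R x) = x" and RQ: "R (Q x) = x" for x
    using half(3-5) by (metis blinfun_apply_blinfun_compose blinfun_apply_id_blinfun id_apply)+
  have B: "self_adjoint B"
    using sB by (simp add: op_le_iff)
  have C_inner: "inner (C x) y = inner (B (Q x)) (Q y)" for x y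
    by (simp add: C_def Q)
  have C: "self_adjoint C"
    using half(2) B unfolding self_adjoint_iff C_def
    by (simp add: complex_linear_compose)
  have AQ: "inner (A (Q x)) (Q x) = (norm x)\<^sup>2" for x
    using R[of x "Q x"] RR[of "Q x"] by (simp add: RQ power2_norm_eq_inner)
  have bounds: "s *\<^sub>R id_blinfun \<le>\<^sub>o\<^sub>p C" "C \<le>\<^sub>o\<^sub>p t *\<^sub>R id_blinfun"
    using sB Bt C AQ
    by (simp_all add: op_le_iff self_adjoint_scaleR blinfun.scaleR_left C_inner
        power2_norm_eq_inner) metis+
  have cont: "continuous_on {s..t} (\<lambda>x. x powr v)"
    by (rule continuous_on_powr_Icc[OF \<open>0 < s\<close>])
  have lin: "cfc (poly [:w, v:]) C = w *\<^sub>R id_blinfun + v *\<^sub>R C" for w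
    by (simp add: cfc_poly[OF C] op_poly_linear)
  have "G \<le>\<^sub>o\<^sub>p cfc (poly [:1 - v - l, v:]) C"
    unfolding G_def op_powr_def
    by (rule cfc_mono[OF bounds cont])
      (use g in \<open>auto intro!: continuous_intros simp: g_fun_def algebra_simps\<close>)
  then have upper: "inner (G x) x \<le> (1 - v - l) * (norm x)\<^sup>2 + v * inner (C x) x" for x
    by (simp add: lin op_le_iff blinfun.bilinear_simps inner_add_left power2_norm_eq_inner)
  have "cfc (poly [:1 - v - u, v:]) C \<le>\<^sub>o\<^sub>p G"
    unfolding G_def op_powr_def
    by (rule cfc_mono[OF bounds _ cont])
      (use g in \<open>auto intro!: continuous_intros simp: g_fun_def algebra_simps\<close>)
  then have lower: "(1 - v - u) * (norm x)\<^sup>2 + v * inner (C x) x \<le> inner (G x) x" for x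
    by (simp add: lin op_le_iff blinfun.bilinear_simps inner_add_left power2_norm_eq_inner)
  have "self_adjoint G"
    unfolding G_def op_powr_def by (rule self_adjoint_cfc[OF bounds cont])
  have geom: "geom_mean v A B = R o\<^sub>L G o\<^sub>L R"
    by (simp add: geom_mean_def R_def Q_def C_def G_def)
  have "self_adjoint (geom_mean v A B)"
    using half(1) \<open>self_adjoint G\<close> unfolding geom self_adjoint_iff
    by (simp add: complex_linear_compose)
  then have D: "self_adjoint (arith_mean v A B - geom_mean v A B)"
    using A(1) B by (simp add: arith_mean_def self_adjoint_add self_adjoint_diff self_adjoint_scaleR)
  have Rz: "(norm (R z))\<^sup>2 = inner (A z) z" "inner (C (R z)) (R z) = inner (B z) z" for z
    using R[of "R z" z] by (simp_all add: power2_norm_eq_inner RR C_inner QR)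
  have D_inner: "inner ((arith_mean v A B - geom_mean v A B) z) z
      = (1 - v) * inner (A z) z + v * inner (B z) z - inner (G (R z)) (R z)" for z
    by (simp add: geom arith_mean_def blinfun.bilinear_simps inner_add_left inner_diff_left R)
  show "l *\<^sub>R A \<le>\<^sub>o\<^sub>p arith_mean v A B - geom_mean v A B"
    unfolding op_le_iff
  proof (intro conjI allI)
    show "inner ((l *\<^sub>R A) z) z \<le> inner ((arith_mean v A B - geom_mean v A B) z) z" for z
      using upper[of "R z"] unfolding D_inner Rz by (simp add: blinfun.scaleR_left algebra_simps)
  qed (use A(1) D in \<open>simp_all add: self_adjoint_scaleR\<close>)
  show "arith_mean v A B - geom_mean v A B \<le>\<^sub>o\<^sub>p u *\<^sub>R A"
    unfolding op_le_iff
  proof (intro conjI allI)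
    show "inner ((arith_mean v A B - geom_mean v A B) z) z \<le> inner ((u *\<^sub>R A) z) z" for z
      using lower[of "R z"] unfolding D_inner Rz by (simp add: blinfun.scaleR_left algebra_simps)
  qed (use A(1) D in \<open>simp_all add: self_adjoint_scaleR\<close>)
qed

lemma g_fun_deriv:
  assumes "0 < x"
  shows "(g_fun v has_real_derivative v * (1 - x powr (v - 1))) (at x)"
  unfolding g_fun_def[abs_def] using assms
  by (auto intro!: derivative_eq_intros simp: algebra_simps)

lemma g_fun_antimono:
  assumes "0 \<le> v" "v \<le> 1" "0 < x" "x \<le> y" "y \<le> 1"
  shows "g_fun v y \<le> g_fun v x"
proof (rule DERIV_nonpos_imp_nonincreasing[OF \<open>x \<le> y\<close>])
  fix z
  assume z: "x \<le> z" "z \<le> y"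
  have "1 powr (v - 1) \<le> z powr (v - 1)"
    using assms z by (intro powr_mono2') auto
  then have "v * (1 - z powr (v - 1)) \<le> 0"
    using assms by (simp add: mult_nonneg_nonpos)
  then show "\<exists>d. (g_fun v has_real_derivative d) (at z) \<and> d \<le> 0"
    using g_fun_deriv assms z by (intro exI conjI) auto
qed

lemma g_fun_mono:
  assumes "0 \<le> v" "v \<le> 1" "1 \<le> x" "x \<le> y"
  shows "g_fun v x \<le> g_fun v y"
proof (rule DERIV_nonneg_imp_nondecreasing[OF \<open>x \<le> y\<close>])
  fix z
  assume z: "x \<le> z" "z \<le> y"
  have "z powr (v - 1) \<le> 1 powr (v - 1)"
    using assms z by (intro powr_mono2') auto
  then have "0 \<le> v * (1 - z powr (v - 1))"
    using assms by simp
  then show "\<exists>d. (g_fun v has_real_derivative d) (at z) \<and> 0 \<le> d"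
    using g_fun_deriv assms z by (intro exI conjI) auto
qed

theorem proposition2p1:
  fixes A B :: "'a::chilbert_space \<Rightarrow>\<^sub>L 'a" and s t v :: real
  assumes "strictly_positive_op A" and "strictly_positive_op B"
    and "0 < s" and "s \<le> t"
    and "s *\<^sub>R A \<le>\<^sub>o\<^sub>p B" and "B \<le>\<^sub>o\<^sub>p t *\<^sub>R A"
    and "0 \<le> v" and "v \<le> 1"
  shows "(t \<le> 1 \<longrightarrow>
            g_fun v t *\<^sub>R A \<le>\<^sub>o\<^sub>p arith_mean v A B - geom_mean v A B \<and>
            arith_mean v A B - geom_mean v A B \<le>\<^sub>o\<^sub>p g_fun v s *\<^sub>R A) \<and>
         (1 \<le> s \<longrightarrow>
            g_fun v s *\<^sub>R A \<le>\<^sub>o\<^sub>p arith_mean v A B - geom_mean v A B \<and>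
            arith_mean v A B - geom_mean v A B \<le>\<^sub>o\<^sub>p g_fun v t *\<^sub>R A)"
proof -
  \<comment> \<open>Self-adjointness of \<open>A\<close> can be read off from \<open>s A \<le> B\<close>, as \<open>s \<noteq> 0\<close>.\<close>
  have "self_adjoint (inverse s *\<^sub>R s *\<^sub>R A)"
    using assms(5) by (simp only: op_le_iff self_adjoint_scaleR)
  then have A: "self_adjoint A"
    using \<open>0 < s\<close> by simp
  note bounds = means_diff_bounds[OF A assms(1) \<open>0 < s\<close> assms(5,6)]
  show ?thesis
  proof (intro conjI impI)
    assume "t \<le> 1"
    then have g: "g_fun v t \<le> g_fun v x \<and> g_fun v x \<le> g_fun v s" if "x \<in> {s..t}" for x
      using that assms by (auto intro!: g_fun_antimono)
    show "g_fun v t *\<^sub>R A \<le>\<^sub>o\<^sub>p arith_mean v A B - geom_mean v A B"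
      "arith_mean v A B - geom_mean v A B \<le>\<^sub>o\<^sub>p g_fun v s *\<^sub>R A"
      using bounds[OF g] by auto
  next
    assume "1 \<le> s"
    then have g: "g_fun v s \<le> g_fun v x \<and> g_fun v x \<le> g_fun v t" if "x \<in> {s..t}" for x
      using that assms by (auto intro!: g_fun_mono)
    show "g_fun v s *\<^sub>R A \<le>\<^sub>o\<^sub>p arith_mean v A B - geom_mean v A B"
      "arith_mean v A B - geom_mean v A B \<le>\<^sub>o\<^sub>p g_fun v t *\<^sub>R A"
      using bounds[OF g] by auto
  qed
qed

end
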